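(* (Knowledge gain) Let $\mathcal C=\langle V_{\mathcal C},S_{\mathcal C},\chi_{\mathcal C},W_{\mathcal C},\ell_{\mathcal C}\rangle$ and $\mathcal D=\langle V_{\mathcal D},S_{\mathcal D},\chi_{\mathcal D},W_{\mathcal D},\ell_{\mathcal D}\rangle$ be simplicial models with vertex labellings, and let $f:\mathcal C\to\mathcal D$ be a morphism. Let $\varphi$ be a guarded positive epistemic formula. Then for every world $X\in W_{\mathcal C}$, $\mathcal D,f(X)\models\varphi$ implies $\mathcal C,X\models\varphi$.
   Context: Fix a finite set $A$ of agents and a set $\mathsf{AP}=\bigcup_{a\in A}\mathsf{AP}_a$ of atomic propositions partitioned by agent; for $B\subseteq A$ write $\mathsf{AP}_B=\bigcup_{b\in B}\mathsf{AP}_b$. A chromatic simplicial complex is $\langle V,S,\chi\rangle$ with $S$ a family of non-empty subsets of $V$ containing all singletons and closed under non-empty subsets, and $\chi:V\to A$ injective on each simplex. A simplicial model (with vertex labelling) is $\langle V,S,\chi,W,\ell\rangle$ with $\langle V,S,\chi\rangle$ a chromatic simplicial complex, a set of worlds $W$ with $\mathrm{Facets}\subseteq W\subseteq S$ (facets = maximal simplices), and $\ell$ assigning to each vertex $v$ a set $\ell(v)\subseteq\mathsf{AP}_{\chi(v)}$; a world $w$ is labelled by $\ell(w)=\bigcup_{v\in w}\ell(v)$. A morphism $f$ from $\langle V_1,S_1,\chi_1,W_1,\ell_1\rangle$ to $\langle V_2,S_2,\chi_2,W_2,\ell_2\rangle$ is a map $f:V_1\to V_2$ sending simplices to simplices,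 with $f(X)\in W_2$ for every $X\in W_1$, $\chi_2(f(v))=\chi_1(v)$ and $\ell_2(f(v))=\ell_1(v)$ for all $v\in V_1$. Satisfaction at a world $w$ of $\mathcal M=\langle V,S,\chi,W,\ell\rangle$: $p$ iff $p\in\ell(w)$; $\neg,\wedge,\vee$ standard; $D_U\varphi$ iff $\varphi$ holds at every $w'\in W$ with $U\subseteq\chi(w\cap w')$; $C_U\varphi$ (common knowledge) iff $\varphi$ holds at every $w'\in W$ reachable from $w$ by a finite sequence $w=w_0,w_1,\dots,w_k=w'$ of worlds ($k\ge0$) such that for each $i$ some $u\in U$ satisfies $u\in\chi(w_i\cap w_{i+1})$. Here $U$ ranges over non-empty subsets of $A$. For $a\in A$, $\mathsf{alive}(a)$ holds at $w$ iff $a\in\chi(w)$ (it abbreviates $\neg D_{\{a\}}\bot$), and $\mathsf{alive}(B):=\bigwedge_{a\in B}\mathsf{alive}(a)$. Guarded positive epistemic formulas: $\varphi::=(\mathsf{alive}(B)\Rightarrow\psi_B)\mid\varphi\wedge\varphi\mid\varphi\vee\varphi\mid D_U\varphi\mid C_U\varphi$ with $U,B\subseteq A$ and $\psi_B$ a propositional formula $\psi_B::=p\mid\neg\psi_B\mid\psi_B\wedge\psi_B$ with $p\in\mathsf{AP}_B$. *)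

theory Defs
  imports Main "HOL-Library.Disjoint_Sets"
begin

definition chromatic_complex ::
  "'a set \<Rightarrow> 'v set \<Rightarrow> 'v set set \<Rightarrow> ('v \<Rightarrow> 'a) \<Rightarrow> bool" where
  "chromatic_complex A V S \<chi> \<longleftrightarrow>
     (\<forall>X\<in>S. X \<noteq> {} \<and> X \<subseteq> V) \<and>
     (\<forall>v\<in>V. {v} \<in> S) \<and>
     (\<forall>X\<in>S. \<forall>Y. Y \<noteq> {} \<and> Y \<subseteq> X \<longrightarrow> Y \<in> S) \<and>
     (\<forall>v\<in>V. \<chi> v \<in> A) \<and>
     (\<forall>X\<in>S. inj_on \<chi> X)"

definition facets :: "'v set set \<Rightarrow> 'v set set" where
  "facets S = {X \<in> S. \<forall>Y\<in>S. X \<subseteq> Y \<longrightarrow> X = Y}"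

record ('v, 'a, 'p) smodel =
  verts :: "'v set"
  simplices :: "'v set set"
  color :: "'v \<Rightarrow> 'a"
  worlds :: "'v set set"
  label :: "'v \<Rightarrow> 'p set"

definition simplicial_model ::
  "'a set \<Rightarrow> ('a \<Rightarrow> 'p set) \<Rightarrow> ('v, 'a, 'p) smodel \<Rightarrow> bool" where
  "simplicial_model A AP M \<longleftrightarrow>
     chromatic_complex A (verts M) (simplices M) (color M) \<and>
     facets (simplices M) \<subseteq> worlds M \<and> worlds M \<subseteq> simplices M \<and>
     (\<forall>v\<in>verts M. label M v \<subseteq> AP (color M v))"

definition world_label :: "('v, 'a, 'p) smodel \<Rightarrow> 'v set \<Rightarrow> 'p set" where
  "world_label M w = (\<Union>v\<in>w. label M v)"

definition smorphism ::
  "('v, 'a, 'p) smodel \<Rightarrow> ('w, 'a, 'p) smodel \<Rightarrow> ('v \<Rightarrow> 'w) \<Rightarrow> bool" where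
  "smorphism M N f \<longleftrightarrow>
     (\<forall>v\<in>verts M. f v \<in> verts N) \<and>
     (\<forall>X\<in>simplices M. f ` X \<in> simplices N) \<and>
     (\<forall>X\<in>worlds M. f ` X \<in> worlds N) \<and>
     (\<forall>v\<in>verts M. color N (f v) = color M v) \<and>
     (\<forall>v\<in>verts M. label N (f v) = label M v)"

datatype ('a, 'p) fm =
    Bot
  | Atom 'p
  | Neg "('a, 'p) fm"
  | And "('a, 'p) fm" "('a, 'p) fm"
  | Or "('a, 'p) fm" "('a, 'p) fm"
  | DK "'a set" "('a, 'p) fm"
  | CK "'a set" "('a, 'p) fm"

definition share_color :: "('v, 'a, 'p) smodel \<Rightarrow> 'a set \<Rightarrow> ('v set \<times> 'v set) set" where
  "share_color M U =
     {(w, w'). w \<in> worlds M \<and> w' \<in> worlds M \<and> (\<exists>u\<in>U. u \<in> color M ` (w \<inter> w'))}"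

primrec sat :: "('v, 'a, 'p) smodel \<Rightarrow> 'v set \<Rightarrow> ('a, 'p) fm \<Rightarrow> bool" where
  "sat M w Bot \<longleftrightarrow> False"
| "sat M w (Atom p) \<longleftrightarrow> p \<in> world_label M w"
| "sat M w (Neg \<phi>) \<longleftrightarrow> \<not> sat M w \<phi>"
| "sat M w (And \<phi> \<psi>) \<longleftrightarrow> sat M w \<phi> \<and> sat M w \<psi>"
| "sat M w (Or \<phi> \<psi>) \<longleftrightarrow> sat M w \<phi> \<or> sat M w \<psi>"
| "sat M w (DK U \<phi>) \<longleftrightarrow>
     (\<forall>w'\<in>worlds M. U \<subseteq> color M ` (w \<inter> w') \<longrightarrow> sat M w' \<phi>)"
| "sat M w (CK U \<phi>) \<longleftrightarrow>
     (\<forall>w'\<in>worlds M. (w, w') \<in> (share_color M U)\<^sup>* \<longrightarrow> sat M w' \<phi>)"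

definition Imp :: "('a, 'p) fm \<Rightarrow> ('a, 'p) fm \<Rightarrow> ('a, 'p) fm" where
  "Imp \<phi> \<psi> = Or (Neg \<phi>) \<psi>"

definition alive :: "'a \<Rightarrow> ('a, 'p) fm" where
  "alive a = Neg (DK {a} Bot)"

text \<open>The finite conjunction over \<open>B\<close> is written out along some enumeration of \<open>B\<close>;
  the choice is immaterial for satisfaction, see \<open>sat_alive_all\<close> below.
  The empty conjunction is \<open>Neg Bot\<close>.\<close>

definition alive_all :: "'a set \<Rightarrow> ('a, 'p) fm" where
  "alive_all B = foldr (\<lambda>a. And (alive a)) (SOME as. set as = B \<and> distinct as) (Neg Bot)"

lemma sat_alive:
  assumes "w \<in> worlds M"
  shows "sat M w (alive a) \<longleftrightarrow> a \<in> color M ` w"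
  using assms by (auto simp: alive_def)

lemma sat_alive_all:
  assumes "finite B" and w: "w \<in> worlds M"
  shows "sat M w (alive_all B) \<longleftrightarrow> (\<forall>a\<in>B. sat M w (alive a))"
proof -
  have "\<exists>as. set as = B \<and> distinct as"
    using assms(1) by (rule finite_distinct_list)
  then have "set (SOME as. set as = B \<and> distinct as) = B"
    by (rule someI2_ex) simp
  moreover have "sat M w (foldr (\<lambda>a. And (alive a)) as (Neg Bot)) \<longleftrightarrow>
      (\<forall>a\<in>set as. sat M w (alive a))" for as
    by (induction as) simp_all
  ultimately show ?thesis
    unfolding alive_all_def by simp
qed

definition atoms_of :: "('a \<Rightarrow> 'p set) \<Rightarrow> 'a set \<Rightarrow> 'p set" where
  "atoms_of AP B = (\<Union>b\<in>B. AP b)"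

inductive propositional :: "('a \<Rightarrow> 'p set) \<Rightarrow> 'a set \<Rightarrow> ('a, 'p) fm \<Rightarrow> bool"
  for AP :: "'a \<Rightarrow> 'p set" and B :: "'a set" where
  "p \<in> atoms_of AP B \<Longrightarrow> propositional AP B (Atom p)"
| "propositional AP B \<psi> \<Longrightarrow> propositional AP B (Neg \<psi>)"
| "propositional AP B \<psi>\<^sub>1 \<Longrightarrow> propositional AP B \<psi>\<^sub>2 \<Longrightarrow> propositional AP B (And \<psi>\<^sub>1 \<psi>\<^sub>2)"

inductive guarded_positive :: "'a set \<Rightarrow> ('a \<Rightarrow> 'p set) \<Rightarrow> ('a, 'p) fm \<Rightarrow> bool"
  for A :: "'a set" and AP :: "'a \<Rightarrow> 'p set" where
  "B \<subseteq> A \<Longrightarrow> propositional AP B \<psi> \<Longrightarrow> guarded_positive A AP (Imp (alive_all B) \<psi>)"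
| "guarded_positive A AP \<phi> \<Longrightarrow> guarded_positive A AP \<psi> \<Longrightarrow> guarded_positive A AP (And \<phi> \<psi>)"
| "guarded_positive A AP \<phi> \<Longrightarrow> guarded_positive A AP \<psi> \<Longrightarrow> guarded_positive A AP (Or \<phi> \<psi>)"
| "U \<subseteq> A \<Longrightarrow> U \<noteq> {} \<Longrightarrow> guarded_positive A AP \<phi> \<Longrightarrow> guarded_positive A AP (DK U \<phi>)"
| "U \<subseteq> A \<Longrightarrow> U \<noteq> {} \<Longrightarrow> guarded_positive A AP \<phi> \<Longrightarrow> guarded_positive A AP (CK U \<phi>)"

end

theory Submission
  imports Defs
begin

text \<open>A morphism preserves the colours and the label of a world, so the guarded propositional
  formulas have the same truth value at \<open>X\<close> and \<open>f ` X\<close>. Since \<open>f ` (X \<inter> Y) \<subseteq> f ` X \<inter> f ` Y\<close>,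
  indistinguishable worlds are sent to indistinguishable worlds, so \<open>D\<^sub>U\<close> and \<open>C\<^sub>U\<close> quantify over
  at least as much in the target as in the source.\<close>

text \<open>A morphism is only required to respect colours and labels on \<open>verts M\<close>;
  this makes those conditions available on the vertices of a world.\<close>

lemma world_subset_verts:
  assumes "simplicial_model A AP M" "X \<in> worlds M"
  shows "X \<subseteq> verts M"
proof -
  have "X \<in> simplices M"
    using assms by (auto simp: simplicial_model_def)
  then show ?thesis
    using assms(1) by (simp add: simplicial_model_def chromatic_complex_def)
qed

lemma smorphism_image_world:
  assumes "smorphism M N f" "X \<in> worlds M"
  shows "f ` X \<in> worlds N"
  using assms by (simp add: smorphism_def)

lemma smorphism_color_image:
  assumes "smorphism M N f" "X \<subseteq> verts M"
  shows "color N ` f ` X = color M ` X"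
  unfolding image_image
  using assms by (intro image_cong) (auto simp: smorphism_def)

lemma smorphism_world_label:
  assumes "smorphism M N f" "X \<subseteq> verts M"
  shows "world_label N (f ` X) = world_label M X"
  unfolding world_label_def image_image
  using assms by (intro arg_cong[where f = Union] image_cong) (auto simp: smorphism_def)

text \<open>The inclusion can be strict: \<open>f\<close> may identify a vertex of \<open>X\<close>
  with a different vertex of \<open>Y\<close>, so the images can share more colours.\<close>

lemma smorphism_color_inter:
  assumes "smorphism M N f" "X \<subseteq> verts M"
  shows "color M ` (X \<inter> Y) \<subseteq> color N ` (f ` X \<inter> f ` Y)"
proof -
  have "color M ` (X \<inter> Y) = color N ` f ` (X \<inter> Y)"
    using assms by (intro smorphism_color_image[symmetric]) auto
  also have "\<dots> \<subseteq> color N ` (f ` X \<inter> f ` Y)"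
    by (intro image_mono image_Int_subset)
  finally show ?thesis .
qed

lemma smorphism_share_color:
  assumes "simplicial_model A AP M" "smorphism M N f" "(X, Y) \<in> share_color M U"
  shows "(f ` X, f ` Y) \<in> share_color N U"
proof -
  have X: "X \<in> worlds M" and Y: "Y \<in> worlds M"
    using assms(3) by (auto simp: share_color_def)
  obtain u where "u \<in> U" "u \<in> color M ` (X \<inter> Y)"
    using assms(3) by (auto simp: share_color_def)
  moreover have "color M ` (X \<inter> Y) \<subseteq> color N ` (f ` X \<inter> f ` Y)"
    using assms(2) world_subset_verts[OF assms(1) X] by (rule smorphism_color_inter)
  ultimately have "\<exists>u\<in>U. u \<in> color N ` (f ` X \<inter> f ` Y)"
    by (meson subsetD)
  then show ?thesis
    using smorphism_image_world[OF assms(2)] X Y by (simp add: share_color_def)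
qed

lemma smorphism_share_color_rtrancl:
  assumes "simplicial_model A AP M" "smorphism M N f" "(X, Y) \<in> (share_color M U)\<^sup>*"
  shows "(f ` X, f ` Y) \<in> (share_color N U)\<^sup>*"
  using assms(3)
proof induction
  case (step Y Z)
  show ?case
    using step.IH smorphism_share_color[OF assms(1,2) step.hyps(2)] by (rule rtrancl_into_rtrancl)
qed simp

text \<open>The equivalence, rather than one implication, is what lets the induction pass through
  \<open>Neg\<close>.\<close>

lemma smorphism_sat_propositional:
  assumes "smorphism M N f" "X \<subseteq> verts M" "propositional AP B \<psi>"
  shows "sat N (f ` X) \<psi> \<longleftrightarrow> sat M X \<psi>"
  using assms(3) by induction (simp_all add: smorphism_world_label[OF assms(1,2)])

text \<open>\<open>alive a\<close> unfolds to the existence of a world sharing colour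
  \<open>a\<close>; a world having that colour is its own witness, so only its set of colours
  matters. Both directions are proved because the guard occurs negated in
  \<open>Imp\<close>.\<close>

lemma smorphism_sat_alive_all:
  assumes "simplicial_model A AP M" "smorphism M N f" "finite B" "X \<in> worlds M"
  shows "sat N (f ` X) (alive_all B) \<longleftrightarrow> sat M X (alive_all B)"
  using assms smorphism_image_world[OF assms(2,4)]
    smorphism_color_image[OF assms(2) world_subset_verts[OF assms(1,4)]]
  by (simp add: sat_alive_all sat_alive)

theorem theorem59:
  fixes A :: "'a set"
    and AP :: "'a \<Rightarrow> 'p set"
    and C :: "('v, 'a, 'p) smodel"
    and D :: "('w, 'a, 'p) smodel"
    and f :: "'v \<Rightarrow> 'w"
    and \<phi> :: "('a, 'p) fm"
  assumes "finite A"
    and "disjoint_family_on AP A"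
    and "simplicial_model A AP C"
    and "simplicial_model A AP D"
    and "smorphism C D f"
    and "guarded_positive A AP \<phi>"
  shows "\<forall>X\<in>worlds C. sat D (f ` X) \<phi> \<longrightarrow> sat C X \<phi>"
  \<comment> \<open>\<open>X\<close> stays quantified in the goal, so the induction hypotheses apply
    at the other worlds reached by \<open>DK\<close> and \<open>CK\<close>.\<close>
  using assms(6)
proof induction
  case (1 B \<psi>)
  have "finite B"
    using 1(1) assms(1) by (rule finite_subset)
  then show ?case
    using smorphism_sat_alive_all[OF assms(3,5)]
      smorphism_sat_propositional[OF assms(5) world_subset_verts[OF assms(3)] 1(2)]
    by (simp add: Imp_def)
next
  case (4 U \<phi>)
  \<comment> \<open>To reach a world \<open>Y\<close> of \<open>C\<close>, the quantifier of
    \<open>DK\<close> in \<open>D\<close> is instantiated with its image.\<close>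
  have "U \<subseteq> color D ` (f ` X \<inter> f ` Y)" if "X \<in> worlds C" "U \<subseteq> color C ` (X \<inter> Y)" for X Y
    using that(2) smorphism_color_inter[OF assms(5) world_subset_verts[OF assms(3) that(1)]]
    by (rule subset_trans)
  then show ?case
    using "4.IH" smorphism_image_world[OF assms(5)] by simp
next
  case (5 U \<phi>)
  then show ?case
    using smorphism_share_color_rtrancl[OF assms(3,5)] smorphism_image_world[OF assms(5)] by simp
qed simp_all

end
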